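(* Let $(W,S)$ be a Coxeter system with $S$ finite. The set $L \subseteq S^*$ of all reduced expressions of cyclically fully commutative elements of $W$ is a regular language over the alphabet $S$ (i.e., it is recognized by a finite deterministic automaton).
   Context: A Coxeter system $(W,S)$ consists of a group $W$ generated by a finite set $S$ of involutions subject to the relations $(st)^{m_{st}}=1$ for $s \neq t$ with $m_{st} \in \{2,3,\ldots\}\cup\{\infty\}$ (no relation if $m_{st}=\infty$). Words in the free monoid $S^*$ are called expressions. The Coxeter length $\ell(w)$ is the minimal length of an expression representing $w$; expressions of that length are reduced expressions, and $R(w)$ denotes the set of reduced expressions of $w$. For $m_{st}=2$ the relation $st=ts$ is a commutation relation. An element $w$ is fully commutative (FC) if any two words of $R(w)$ can be linked by a sequence of commutation relations (swapping adjacent letters $s,t$ with $m_{st}=2$). A cyclic shift of a word $s_1\cdots s_n$ is any word $s_k s_{k+1}\cdots s_n s_1 \cdots s_{k-1}$ for $k\in\{1,\ldots,n\}$. An element $w \in W$ is cyclically fully commutative (CFC) if every cyclic shift of every word in $R(w)$ is a reduced expression of some fully commutative element (possibly different from $w$). *)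

theory Defs
  imports Main "HOL-Library.Extended_Nat"
begin

text \<open>A Coxeter system is given by a finite generating set S and a Coxeter matrix
m, with m s t = m t s and m s t \<in> {2,3,...} \<union> {\<infinity>} for s \<noteq> t.
The group W is presented by the involutions s \<in> S subject to (st)^(m s t) = 1.
Since all generators are involutions, W is the quotient of the free monoid S*
by the congruence generated by ss = 1 and (st)^(m s t) = 1 (m s t finite).
Elements of W are represented by words; two words represent the same element
iff they are equivalent under this congruence.\<close>

definition coxeter_matrix :: "'a set \<Rightarrow> ('a \<Rightarrow> 'a \<Rightarrow> enat) \<Rightarrow> bool" where
  "coxeter_matrix S m \<longleftrightarrow>
     (\<forall>s\<in>S. \<forall>t\<in>S. m s t = m t s) \<and>
     (\<forall>s\<in>S. \<forall>t\<in>S. s \<noteq> t \<longrightarrow> m s t \<ge> 2)"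

definition relator :: "'a set \<Rightarrow> ('a \<Rightarrow> 'a \<Rightarrow> enat) \<Rightarrow> 'a list \<Rightarrow> bool" where
  "relator S m r \<longleftrightarrow>
     (\<exists>s\<in>S. r = [s, s]) \<or>
     (\<exists>s\<in>S. \<exists>t\<in>S. \<exists>k. s \<noteq> t \<and> m s t = enat k \<and> r = concat (replicate k [s, t]))"

definition rel_step :: "'a set \<Rightarrow> ('a \<Rightarrow> 'a \<Rightarrow> enat) \<Rightarrow> 'a list \<Rightarrow> 'a list \<Rightarrow> bool" where
  "rel_step S m x y \<longleftrightarrow> (\<exists>u v r. relator S m r \<and> x = u @ r @ v \<and> y = u @ v)"

definition same_elem :: "'a set \<Rightarrow> ('a \<Rightarrow> 'a \<Rightarrow> enat) \<Rightarrow> 'a list \<Rightarrow> 'a list \<Rightarrow> bool" where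
  "same_elem S m x y \<longleftrightarrow> x \<in> lists S \<and> y \<in> lists S \<and> equivclp (rel_step S m) x y"

definition cox_length :: "'a set \<Rightarrow> ('a \<Rightarrow> 'a \<Rightarrow> enat) \<Rightarrow> 'a list \<Rightarrow> nat" where
  "cox_length S m x = (LEAST n. \<exists>y. same_elem S m x y \<and> length y = n)"

definition reduced :: "'a set \<Rightarrow> ('a \<Rightarrow> 'a \<Rightarrow> enat) \<Rightarrow> 'a list \<Rightarrow> bool" where
  "reduced S m x \<longleftrightarrow> x \<in> lists S \<and> length x = cox_length S m x"

definition red_exprs :: "'a set \<Rightarrow> ('a \<Rightarrow> 'a \<Rightarrow> enat) \<Rightarrow> 'a list \<Rightarrow> 'a list set" where
  "red_exprs S m x = {y. reduced S m y \<and> same_elem S m x y}"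

definition comm_step :: "('a \<Rightarrow> 'a \<Rightarrow> enat) \<Rightarrow> 'a list \<Rightarrow> 'a list \<Rightarrow> bool" where
  "comm_step m x y \<longleftrightarrow> (\<exists>u v s t. m s t = 2 \<and> x = u @ [s, t] @ v \<and> y = u @ [t, s] @ v)"

definition fully_commutative :: "'a set \<Rightarrow> ('a \<Rightarrow> 'a \<Rightarrow> enat) \<Rightarrow> 'a list \<Rightarrow> bool" where
  "fully_commutative S m x \<longleftrightarrow>
     (\<forall>y\<in>red_exprs S m x. \<forall>z\<in>red_exprs S m x. (comm_step m)\<^sup>*\<^sup>* y z)"

definition cyc_fully_commutative :: "'a set \<Rightarrow> ('a \<Rightarrow> 'a \<Rightarrow> enat) \<Rightarrow> 'a list \<Rightarrow> bool" where
  "cyc_fully_commutative S m x \<longleftrightarrow>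
     (\<forall>y\<in>red_exprs S m x. \<forall>k. reduced S m (rotate k y) \<and> fully_commutative S m (rotate k y))"

definition regular_lang :: "'a set \<Rightarrow> 'a list set \<Rightarrow> bool" where
  "regular_lang S L \<longleftrightarrow> L \<subseteq> lists S \<and>
     (\<exists>(Q :: nat set) q0 (\<delta> :: nat \<Rightarrow> 'a \<Rightarrow> nat) F.
        finite Q \<and> q0 \<in> Q \<and> (\<forall>q\<in>Q. \<forall>a\<in>S. \<delta> q a \<in> Q) \<and> F \<subseteq> Q \<and>
        (\<forall>w\<in>lists S. w \<in> L \<longleftrightarrow> foldl \<delta> q0 w \<in> F))"

end

theory Submission
  imports Defs Complex_Main
begin

text \<open>By Matsumoto's theorem, a word is a reduced expression of a fully commutative element iff no
  word in its commutation class has a factor \<open>ss\<close> or an alternating factor \<open>stst\<dots>\<close> of length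
  \<open>m s t \<ge> 3\<close>. The commutation class of such a word consists of all its reduced expressions. Hence the
  language in question consists of the words \<open>x\<close> such that \<open>v @ u\<close> avoids these finitely many factors,
  up to commutations, whenever \<open>u @ v\<close> is commutation equivalent to \<open>x\<close>. Reading a word letter by
  letter, a finite automaton can keep track of all factorizations of its trace into three factors as far
  as the support of each factor and the short factors themselves are concerned, which shows that the
  avoiding words form a regular language. Keeping track of all factorizations into two factors, each
  labelled with its support and its action on the states of the first automaton, decides the condition
  on the conjugates \<open>v @ u\<close>.\<close>

section \<open>Regular languages of traces\<close>

text \<open>As in the Myhill-Nerode theorem, \<open>f x\<close> stands for the state reached after
  reading \<open>x\<close>. The label type is left open because sets of factorizations and relations
  on states will serve as labels.\<close>

definition right_congruence :: "'a set \<Rightarrow> ('a list \<Rightarrow> 'b) \<Rightarrow> bool" where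
  "right_congruence S f \<longleftrightarrow> finite (f ` lists S) \<and>
     (\<forall>x\<in>lists S. \<forall>y\<in>lists S. \<forall>a\<in>S. f x = f y \<longrightarrow> f (x @ [a]) = f (y @ [a]))"

lemma right_congruence_finite: "right_congruence S f \<Longrightarrow> finite (f ` lists S)"
  by (simp add: right_congruence_def)

lemma right_congruence_append:
  assumes "right_congruence S f" "x \<in> lists S" "y \<in> lists S" "w \<in> lists S" "f x = f y"
  shows "f (x @ w) = f (y @ w)"
  using assms(4)
proof (induction w rule: rev_induct)
  case Nil
  then show ?case using assms(5) by simp
next
  case (snoc a w)
  then have "f (x @ w) = f (y @ w)" "x @ w \<in> lists S" "y @ w \<in> lists S" "a \<in> S"
    using assms(2,3) by auto
  then show ?case
    using assms(1) by (simp add: right_congruence_def flip: append_assoc)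
qed

text \<open>The labels, numbered by an injection \<open>h\<close>, are the states; a transition
  appends the letter to a chosen representative of the state, which is well defined by the
  congruence property. By saturation \<open>L\<close> is a union of label classes.\<close>

lemma regular_lang_if_right_congruence:
  assumes f: "right_congruence S f" and L: "L \<subseteq> lists S"
    and sat: "\<And>x y. x \<in> L \<Longrightarrow> y \<in> lists S \<Longrightarrow> f x = f y \<Longrightarrow> y \<in> L"
  shows "regular_lang S L"
proof -
  have fin: "finite (f ` lists S)" using f by (simp add: right_congruence_def)
  then obtain h :: "_ \<Rightarrow> nat" where h: "inj_on h (f ` lists S)"
    using finite_imp_inj_to_nat_seg by metis
  define rep where "rep q = (SOME x. x \<in> lists S \<and> h (f x) = q)" for q
  define \<delta> where "\<delta> q a = h (f (rep q @ [a]))" for q a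
  have rep: "rep (h (f x)) \<in> lists S \<and> f (rep (h (f x))) = f x" if "x \<in> lists S" for x
  proof -
    have "rep (h (f x)) \<in> lists S \<and> h (f (rep (h (f x)))) = h (f x)"
      unfolding rep_def by (rule someI[of _ x]) (simp add: that)
    then show ?thesis using h that by (auto dest: inj_onD)
  qed
  have step: "\<delta> (h (f x)) a = h (f (x @ [a]))" if "x \<in> lists S" "a \<in> S" for x a
  proof -
    have "f (rep (h (f x)) @ [a]) = f (x @ [a])"
      using f rep[OF that(1)] that unfolding right_congruence_def by blast
    then show ?thesis by (simp add: \<delta>_def)
  qed
  have run: "foldl \<delta> (h (f [])) w = h (f w)" if "w \<in> lists S" for w
    using that by (induction w rule: rev_induct) (auto simp: step)
  show ?thesis
    unfolding regular_lang_def
  proof (intro conjI exI ballI)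
    show "L \<subseteq> lists S" by (rule L)
    show "finite (h ` f ` lists S)" using fin by simp
    show "h (f []) \<in> h ` f ` lists S" by auto
    show "h ` f ` L \<subseteq> h ` f ` lists S" using L by auto
    show "\<delta> q a \<in> h ` f ` lists S" if q: "q \<in> h ` f ` lists S" and a: "a \<in> S" for q a
    proof -
      from q obtain x where "x \<in> lists S" "q = h (f x)" by auto
      with a show ?thesis by (auto simp: step simp del: in_lists_conv_set intro!: imageI)
    qed
    show "w \<in> L \<longleftrightarrow> foldl \<delta> (h (f [])) w \<in> h ` f ` L" if w: "w \<in> lists S" for w
    proof
      assume "foldl \<delta> (h (f [])) w \<in> h ` f ` L"
      then obtain x where x: "x \<in> L" "h (f w) = h (f x)" using run[OF w] by auto
      then have "f x = f w" using h w L by (metis imageI inj_onD subsetD)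
      then show "w \<in> L" using sat x w by blast
    qed (auto simp: run[OF w])
  qed
qed

text \<open>Finds the block of a factorization in which a marked letter lies, so that the letter can
  be removed there.\<close>

lemma concat_eq_append_Cons:
  "concat zs = p @ a # q \<Longrightarrow>
     \<exists>xs z1 z2 ys. zs = xs @ (z1 @ a # z2) # ys \<and> p = concat xs @ z1 \<and> q = z2 @ concat ys"
proof (induction zs arbitrary: p)
  case (Cons z zs)
  then consider w where "z = p @ a # w" "q = w @ concat zs" | w where "p = z @ w" "concat zs = w @ a # q"
    by (auto simp: append_eq_append_conv2 append_eq_Cons_conv Cons_eq_append_conv)
  then show ?case
  proof cases
    case 1
    then have "z # zs = [] @ (p @ a # w) # zs \<and> p = concat [] @ p \<and> q = w @ concat zs" by simp
    then show ?thesis by blast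
  next
    case 2
    from Cons.IH[OF 2(2)] obtain xs z1 z2 ys where
      "zs = xs @ (z1 @ a # z2) # ys" "w = concat xs @ z1" "q = z2 @ concat ys" by blast
    then have "z # zs = (z # xs) @ (z1 @ a # z2) # ys \<and> p = concat (z # xs) @ z1 \<and> q = z2 @ concat ys"
      using 2 by simp
    then show ?thesis by blast
  qed
qed simp

section \<open>Words modulo commutation of independent letters\<close>

locale trace_alphabet =
  fixes S :: "'a set" and I :: "'a \<Rightarrow> 'a \<Rightarrow> bool"
  assumes finS: "finite S" and sym_I: "I a b \<Longrightarrow> I b a"
begin

definition swap :: "'a list \<Rightarrow> 'a list \<Rightarrow> bool" where
  "swap x y \<longleftrightarrow> (\<exists>u v a b. I a b \<and> x = u @ [a, b] @ v \<and> y = u @ [b, a] @ v)"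

definition Tr :: "'a list \<Rightarrow> 'a list \<Rightarrow> bool" where
  "Tr = swap\<^sup>*\<^sup>*"

lemma swap_sym: "swap x y \<Longrightarrow> swap y x"
  unfolding swap_def using sym_I by blast

lemma Tr_refl [simp]: "Tr x x"
  by (simp add: Tr_def)

lemma Tr_trans [trans]: "Tr x y \<Longrightarrow> Tr y z \<Longrightarrow> Tr x z"
  unfolding Tr_def by simp

lemma Tr_sym: "Tr x y \<Longrightarrow> Tr y x"
  unfolding Tr_def
proof (induction rule: rtranclp_induct)
  case (step y z)
  then show ?case by (metis converse_rtranclp_into_rtranclp swap_sym)
qed simp

lemma swap_context: "swap x y \<Longrightarrow> swap (u @ x @ v) (u @ y @ v)"
  unfolding swap_def by (metis append.assoc)

lemma Tr_context: "Tr x y \<Longrightarrow> Tr (u @ x @ v) (u @ y @ v)"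
  unfolding Tr_def
proof (induction rule: rtranclp_induct)
  case (step y z)
  then show ?case by (meson rtranclp.rtrancl_into_rtrancl swap_context)
qed simp

lemma Tr_append: "Tr x x' \<Longrightarrow> Tr y y' \<Longrightarrow> Tr (x @ y) (x' @ y')"
  using Tr_context[of x x' "[]" y] Tr_context[of y y' x' "[]"] Tr_trans by auto

lemma Tr_set_length: "Tr x y \<Longrightarrow> set y = set x \<and> length y = length x"
  unfolding Tr_def
proof (induction rule: rtranclp_induct)
  case (step y z)
  from step(2) have "set z = set y \<and> length z = length y" unfolding swap_def by auto
  then show ?case using step(3) by simp
qed simp

lemma Tr_lists: "Tr x y \<Longrightarrow> x \<in> lists S \<longleftrightarrow> y \<in> lists S"
  by (auto dest: Tr_set_length)

lemma Tr_letter_right: "\<forall>b\<in>set q. I a b \<Longrightarrow> Tr (a # q) (q @ [a])"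
proof (induction q)
  case (Cons b q)
  have "Tr (a # b # q) (b # a # q)"
    unfolding Tr_def swap_def using Cons.prems by (intro r_into_rtranclp) force
  also have "Tr (b # a # q) (b # q @ [a])"
    using Tr_context[of "a # q" "q @ [a]" "[b]" "[]"] Cons by simp
  finally show ?case by simp
qed simp

text \<open>The appended occurrence of \<open>a\<close> is tracked through the swaps: the letters
  now to its right are those it has passed, and erasing it leaves a word still equivalent to
  \<open>x\<close>.\<close>

lemma Tr_snocD:
  assumes "Tr (x @ [a]) y"
  shows "\<exists>p q. y = p @ a # q \<and> (\<forall>b\<in>set q. I a b) \<and> Tr x (p @ q)"
  using assms unfolding Tr_def
proof (induction rule: rtranclp_induct)
  case base
  show ?case by (rule exI[of _ x], rule exI[of _ "[]"]) simp
next
  case (step y z)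
  then obtain p q where y: "y = p @ a # q" and q: "\<forall>b\<in>set q. I a b" and x: "swap\<^sup>*\<^sup>* x (p @ q)"
    by blast
  from step(2) obtain u v c d where I: "I c d" and y': "y = u @ [c, d] @ v" and z: "z = u @ [d, c] @ v"
    unfolding swap_def by blast
  have eq: "p @ a # q = u @ c # d # v" using y y' by simp
  \<comment> \<open>The swap lies left of the tracked \<open>a\<close>, has it as its right letter,
    has it as its left letter, or lies right of it. In the two middle cases the word without
    \<open>a\<close> does not change.\<close>
  then consider w where "p = u @ c # d # w" "v = w @ a # q"
    | "p = u @ [c]" "a = d" "v = q"
    | "p = u" "a = c" "q = d # v"
    | w where "u = p @ a # w" "q = w @ c # d # v"
    by (auto simp: append_eq_append_conv2 append_eq_Cons_conv Cons_eq_append_conv)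
  then show ?case
  proof cases
    case 1
    have "swap (p @ q) ((u @ d # c # w) @ q)"
      unfolding swap_def using 1 I by force
    then have "z = (u @ d # c # w) @ a # q \<and> (\<forall>b\<in>set q. I a b) \<and> swap\<^sup>*\<^sup>* x ((u @ d # c # w) @ q)"
      using x q z 1 by auto
    then show ?thesis by blast
  next
    case 2
    then have "z = u @ a # (c # v) \<and> (\<forall>b\<in>set (c # v). I a b) \<and> swap\<^sup>*\<^sup>* x (u @ (c # v))"
      using x q z I sym_I by auto
    then show ?thesis by blast
  next
    case 3
    then have "z = (u @ [d]) @ a # v \<and> (\<forall>b\<in>set v. I a b) \<and> swap\<^sup>*\<^sup>* x ((u @ [d]) @ v)"
      using x q z by auto
    then show ?thesis by blast
  next
    case 4
    have "swap (p @ q) (p @ (w @ d # c # v))"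
      unfolding swap_def using I unfolding 4 by (metis append.assoc append_Cons append_Nil)
    then have "z = p @ a # (w @ d # c # v) \<and> (\<forall>b\<in>set (w @ d # c # v). I a b) \<and> swap\<^sup>*\<^sup>* x (p @ (w @ d # c # v))"
      using x q z 4 by auto
    then show ?thesis by blast
  qed
qed

section \<open>Labels of trace factorizations\<close>

definition trace_label :: "('a list \<Rightarrow> 'b) \<Rightarrow> bool" where
  "trace_label g \<longleftrightarrow> right_congruence S g \<and>
     (\<forall>x y. x \<in> lists S \<longrightarrow> Tr x y \<longrightarrow> g x = g y) \<and>
     (\<forall>x\<in>lists S. \<forall>y\<in>lists S. g x = g y \<longrightarrow> set x = set y)"

lemma trace_labelD:
  assumes "trace_label g" "x \<in> lists S"
  shows trace_label_Tr: "Tr x y \<Longrightarrow> g x = g y"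
    and trace_label_set: "y \<in> lists S \<Longrightarrow> g x = g y \<Longrightarrow> set x = set y"
    and trace_label_snoc: "y \<in> lists S \<Longrightarrow> a \<in> S \<Longrightarrow> g x = g y \<Longrightarrow> g (x @ [a]) = g (y @ [a])"
  using assms unfolding trace_label_def right_congruence_def by blast+

text \<open>Because a letter appended to a trace can be inserted into any factor whose successors
  it commutes with, the labels of all factorizations into \<open>k\<close> traces can be updated letter by letter,
  as soon as the label of a factor reveals its support.\<close>

definition splits :: "nat \<Rightarrow> ('a list \<Rightarrow> 'b) \<Rightarrow> 'a list \<Rightarrow> 'b list set" where
  "splits k g x = {map g zs | zs. length zs = k \<and> Tr x (concat zs)}"

lemma splits_Tr: "Tr x y \<Longrightarrow> splits k g x = splits k g y"
  unfolding splits_def by (metis Tr_sym Tr_trans)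

text \<open>The last \<open>a\<close> is removed from its block, the remaining factorization of
  \<open>x\<close> is exchanged for one of \<open>y\<close> with the same labels, and
  \<open>a\<close> is put back at the end of the corresponding block. It can pass the later blocks
  because equal labels give equal supports.\<close>

lemma splits_snoc_mono:
  assumes g: "trace_label g" and xy: "x \<in> lists S" "y \<in> lists S" "a \<in> S"
    and eq: "splits k g x = splits k g y"
  shows "splits k g (x @ [a]) \<subseteq> splits k g (y @ [a])"
proof
  fix l assume "l \<in> splits k g (x @ [a])"
  then obtain zs where l: "l = map g zs" "length zs = k" and tr: "Tr (x @ [a]) (concat zs)"
    unfolding splits_def by blast
  from Tr_snocD[OF tr] obtain p q where pq: "concat zs = p @ a # q" "\<forall>b\<in>set q. I a b" "Tr x (p @ q)"
    by blast
  from concat_eq_append_Cons[OF pq(1)] obtain us z1 z2 vs where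
    zs: "zs = us @ (z1 @ a # z2) # vs" and p: "p = concat us @ z1" and q: "q = z2 @ concat vs" by blast
  have inS: "p @ q \<in> lists S" using Tr_lists[OF pq(3)] xy by blast
  have "length (us @ (z1 @ z2) # vs) = k \<and> Tr x (concat (us @ (z1 @ z2) # vs))"
    using pq(3) p q zs l(2) by simp
  then have "map g (us @ (z1 @ z2) # vs) \<in> splits k g x"
    unfolding splits_def by blast
  then have "map g (us @ (z1 @ z2) # vs) \<in> splits k g y" using eq by simp
  then obtain zs' where zs': "map g (us @ (z1 @ z2) # vs) = map g zs'" "length zs' = k" "Tr y (concat zs')"
    unfolding splits_def by blast
  from zs'(1) have "map g zs' = map g us @ g (z1 @ z2) # map g vs" by simp
  then obtain us' z' vs' where zs'_eq: "zs' = us' @ z' # vs'" "map g us' = map g us"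
    "g z' = g (z1 @ z2)" "map g vs' = map g vs"
  proof -
    assume *: "\<And>us' z' vs'. zs' = us' @ z' # vs' \<Longrightarrow> map g us' = map g us \<Longrightarrow>
      g z' = g (z1 @ z2) \<Longrightarrow> map g vs' = map g vs \<Longrightarrow> thesis"
    from \<open>map g zs' = _\<close> obtain us' ws where "zs' = us' @ ws" "map g us' = map g us"
      "map g ws = g (z1 @ z2) # map g vs" by (auto simp: map_eq_append_conv)
    then show thesis using * by (auto simp: map_eq_Cons_conv)
  qed
  have inS': "concat zs' \<in> lists S" using Tr_lists[OF zs'(3)] xy by blast
  have "I a b" if b: "b \<in> set (concat vs')" for b
  proof -
    from b obtain v' where v': "v' \<in> set vs'" "b \<in> set v'" by auto
    then have "g v' \<in> set (map g vs)" using zs'_eq(4) by (metis image_eqI set_map)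
    then obtain v where v: "v \<in> set vs" "g v' = g v" by auto
    have "v' \<in> lists S" "v \<in> lists S" using v v' inS inS' q zs'_eq(1) by auto
    then have "set v' = set v" using trace_label_set[OF g] v(2) by blast
    then show ?thesis using pq(2) q v v' by auto
  qed
  then have "\<forall>b\<in>set (concat vs'). I a b" by blast
  then have "Tr (a # concat vs') (concat vs' @ [a])" by (rule Tr_letter_right)
  then have "Tr (concat us' @ z' @ concat vs' @ [a]) (concat us' @ z' @ a # concat vs')"
    using Tr_context[OF Tr_sym, of _ _ "concat us' @ z'" "[]"] by fastforce
  moreover have "Tr (y @ [a]) (concat us' @ z' @ concat vs' @ [a])"
    using Tr_append[OF zs'(3) Tr_refl, of "[a]"] zs'_eq(1) by simp
  ultimately have "Tr (y @ [a]) (concat (us' @ (z' @ [a]) # vs'))"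
    using Tr_trans by fastforce
  \<comment> \<open>In the original block \<open>a\<close> may stand before \<open>z2\<close>; it
    commutes with \<open>z2\<close>, so the block is equivalent to \<open>z1 @ z2 @ [a]\<close>,
    whose label follows from that of \<open>z1 @ z2\<close>.\<close>
  moreover have "g (z' @ [a]) = g (z1 @ a # z2)"
  proof -
    have "z' \<in> lists S" "z1 @ z2 \<in> lists S" using inS' inS p q zs'_eq(1) by auto
    then have "g (z' @ [a]) = g (z1 @ z2 @ [a])"
      using trace_label_snoc[OF g, of z' "z1 @ z2" a] zs'_eq(3) xy(3) by simp
    moreover have "Tr (z1 @ z2 @ [a]) (z1 @ a # z2)"
      using Tr_context[OF Tr_sym[OF Tr_letter_right[of z2 a]], of z1 "[]"] pq(2) q by simp
    moreover have "z1 @ z2 @ [a] \<in> lists S" using inS p q xy(3) by auto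
    ultimately show ?thesis using trace_label_Tr[OF g] by simp
  qed
  then have "map g (us' @ (z' @ [a]) # vs') = l"
    using zs'_eq l zs by simp
  moreover have "length (us' @ (z' @ [a]) # vs') = k" using zs'(2) zs'_eq(1) by simp
  ultimately show "l \<in> splits k g (y @ [a])" unfolding splits_def by blast
qed

lemma splits_right_congruence:
  assumes g: "trace_label g"
  shows "right_congruence S (splits k g)"
  unfolding right_congruence_def
proof (intro conjI ballI impI)
  have "splits k g x \<subseteq> {l. set l \<subseteq> g ` lists S \<and> length l = k}" if "x \<in> lists S" for x
  proof
    fix l assume "l \<in> splits k g x"
    then obtain zs where zs: "l = map g zs" "length zs = k" "Tr x (concat zs)"
      unfolding splits_def by blast
    have "set zs \<subseteq> lists S" using Tr_lists[OF zs(3)] that by auto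
    then show "l \<in> {l. set l \<subseteq> g ` lists S \<and> length l = k}" using zs by auto
  qed
  moreover have "finite {l. set l \<subseteq> g ` lists S \<and> length l = k}"
    using g unfolding trace_label_def right_congruence_def by (intro finite_lists_length_eq) blast
  ultimately show "finite (splits k g ` lists S)"
    by (meson PowI finite_Pow_iff finite_subset image_subsetI)
  show "splits k g (x @ [a]) = splits k g (y @ [a])"
    if "x \<in> lists S" "y \<in> lists S" "a \<in> S" "splits k g x = splits k g y" for x y a
    using splits_snoc_mono[OF g that] splits_snoc_mono[OF g that(2,1,3) that(4)[symmetric]]
    by (rule subset_antisym)
qed

text \<open>The second component is the full commutation class of a word of length at most
  \<open>N\<close>. The empty set, which is never such a class, marks the longer words.\<close>

definition short_label :: "nat \<Rightarrow> 'a list \<Rightarrow> 'a set \<times> 'a list set" where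
  "short_label N z = (set z, if length z \<le> N then {c. Tr z c} else {})"

lemma short_label_eqD:
  assumes "short_label N c = short_label N z" "length c \<le> N"
  shows "Tr z c"
proof -
  have "c \<in> snd (short_label N c)" using assms(2) by (simp add: short_label_def)
  then have "c \<in> snd (short_label N z)" using assms(1) by simp
  then show ?thesis by (simp add: short_label_def split: if_splits)
qed

lemma short_label_Tr: "Tr x y \<Longrightarrow> short_label N x = short_label N y"
proof -
  assume tr: "Tr x y"
  then have "{c. Tr x c} = {c. Tr y c}" using Tr_trans Tr_sym by blast
  then show ?thesis using Tr_set_length[OF tr] by (simp add: short_label_def)
qed

text \<open>For short words equal labels mean equal traces. A long word stays long when a letter is
  appended, so there only the support has to be updated.\<close>

lemma trace_label_short_label: "trace_label (short_label N)"
  unfolding trace_label_def right_congruence_def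
proof (intro conjI ballI allI impI)
  show "finite (short_label N ` lists S)"
  proof (rule finite_subset)
    show "short_label N ` lists S \<subseteq> Pow S \<times> Pow {c. set c \<subseteq> S \<and> length c \<le> N}"
    proof (rule image_subsetI)
      fix z assume z: "z \<in> lists S"
      have "(if length z \<le> N then {c. Tr z c} else {}) \<subseteq> {c. set c \<subseteq> S \<and> length c \<le> N}"
      proof
        fix c assume "c \<in> (if length z \<le> N then {c. Tr z c} else {})"
        then have tr: "Tr z c" and "length z \<le> N" by (auto split: if_splits)
        have "c \<in> lists S" using Tr_lists[OF tr] z by blast
        moreover have "length c \<le> N" using Tr_set_length[OF tr] \<open>length z \<le> N\<close> by simp
        ultimately show "c \<in> {c. set c \<subseteq> S \<and> length c \<le> N}" by auto
      qed
      then show "short_label N z \<in> Pow S \<times> Pow {c. set c \<subseteq> S \<and> length c \<le> N}"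
        using z unfolding short_label_def by blast
    qed
    show "finite (Pow S \<times> Pow {c. set c \<subseteq> S \<and> length c \<le> N})"
      using finS finite_lists_length_le by blast
  qed
  show "short_label N (x @ [a]) = short_label N (y @ [a])"
    if "short_label N x = short_label N y" for x y a
  proof (cases "length x \<le> N \<or> length y \<le> N")
    case True
    then have "Tr x y"
      using short_label_eqD[OF that[symmetric]] Tr_sym[OF short_label_eqD[OF that]] by blast
    then show ?thesis by (intro short_label_Tr Tr_append Tr_refl)
  next
    case False
    then show ?thesis using that by (simp add: short_label_def)
  qed
  show "set x = set y" if "short_label N x = short_label N y" for x y
    using that by (simp add: short_label_def)
qed (rule short_label_Tr)

text \<open>The transition function of \<open>x\<close> on the states \<open>f\<close>: unlike \<open>f\<close> itself it determines
  the state of a product in both factors.\<close>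

definition actions :: "('a list \<Rightarrow> 'b) \<Rightarrow> 'a list \<Rightarrow> ('b \<times> 'b) set" where
  "actions f x = (\<lambda>u. (f u, f (u @ x))) ` lists S"

text \<open>The factors are replaced one at a time: \<open>x\<close> by \<open>x'\<close> through
  the congruence property of \<open>f\<close>, then \<open>y\<close> by \<open>y'\<close> because
  equal actions agree from every state, in particular from that of \<open>x'\<close>.\<close>

lemma actions_eq_append:
  assumes f: "right_congruence S f"
    and w: "x \<in> lists S" "x' \<in> lists S" "y \<in> lists S" "y' \<in> lists S"
    and eq: "actions f x = actions f x'" "actions f y = actions f y'"
  shows "f (x @ y) = f (x' @ y')"
proof -
  have *: "f (u @ z) = f (u @ z')"
    if "u \<in> lists S" "z \<in> lists S" "z' \<in> lists S" "actions f z = actions f z'" for u z z'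
  proof -
    have "(f u, f (u @ z)) \<in> actions f z'" using that unfolding actions_def by blast
    then obtain v where "v \<in> lists S" "f u = f v" "f (u @ z) = f (v @ z')"
      unfolding actions_def by auto
    then show ?thesis using right_congruence_append[OF f] that by metis
  qed
  have "f x = f x'" using *[of "[]" x x'] w eq by simp
  then have "f (x @ y) = f (x' @ y)" using right_congruence_append[OF f] w by blast
  then show ?thesis using *[of x' y y'] w eq by simp
qed

lemma actions_right_congruence:
  assumes f: "right_congruence S f"
  shows "right_congruence S (actions f)"
  unfolding right_congruence_def
proof (intro conjI ballI impI)
  show "finite (actions f ` lists S)"
  proof (rule finite_subset)
    show "actions f ` lists S \<subseteq> Pow (f ` lists S \<times> f ` lists S)"
      unfolding actions_def by fastforce
    show "finite (Pow (f ` lists S \<times> f ` lists S))"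
      using right_congruence_finite[OF f] by blast
  qed
  fix x y a assume xy: "x \<in> lists S" "y \<in> lists S" "a \<in> S" and eq: "actions f x = actions f y"
  have "f (u @ x @ [a]) = f (u @ y @ [a])" if "u \<in> lists S" for u
  proof -
    have "f (u @ x) = f (u @ y)"
      using actions_eq_append[OF f that that xy(1,2) refl eq] .
    then show ?thesis using f xy that unfolding right_congruence_def
      by (metis append.assoc append_in_lists_conv)
  qed
  then show "actions f (x @ [a]) = actions f (y @ [a])" unfolding actions_def by (intro image_cong) auto
qed

text \<open>Each factorization into two blocks is labelled by supports, as a
  \<open>trace_label\<close> requires, and by actions. Actions can be composed in either order, so
  the labels of \<open>u\<close> and \<open>v\<close> determine \<open>f (v @ u)\<close> although
  the word read is \<open>u @ v\<close>.\<close>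

lemma regular_lang_conjugates:
  assumes f: "right_congruence S f" and f_Tr: "\<And>x y. x \<in> lists S \<Longrightarrow> Tr x y \<Longrightarrow> f x = f y"
    and sat: "\<And>x y. x \<in> lists S \<Longrightarrow> y \<in> lists S \<Longrightarrow> f x = f y \<Longrightarrow> x \<in> K \<Longrightarrow> y \<in> K"
  shows "regular_lang S {x \<in> lists S. \<forall>u v. Tr x (u @ v) \<longrightarrow> v @ u \<in> K}"
proof -
  define g where "g z = (set z, actions f z)" for z
  have act_Tr: "actions f x = actions f y" if "x \<in> lists S" "Tr x y" for x y
  proof -
    have "f (u @ x) = f (u @ y)" if "u \<in> lists S" for u
      using f_Tr[OF _ Tr_append[OF Tr_refl \<open>Tr x y\<close>]] \<open>x \<in> lists S\<close> that by simp
    then show ?thesis unfolding actions_def by (intro image_cong) auto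
  qed
  have "trace_label g"
    unfolding trace_label_def right_congruence_def
  proof (intro conjI ballI allI impI)
    have "g ` lists S \<subseteq> Pow S \<times> actions f ` lists S" unfolding g_def by auto
    then show "finite (g ` lists S)"
      using finS right_congruence_finite[OF actions_right_congruence[OF f]]
      by (meson finite_Pow_iff finite_SigmaI finite_subset)
    show "g (x @ [a]) = g (y @ [a])" if "x \<in> lists S" "y \<in> lists S" "a \<in> S" "g x = g y" for x y a
    proof -
      have "actions f x = actions f y" "set x = set y" using that(4) by (simp_all add: g_def)
      then have "actions f (x @ [a]) = actions f (y @ [a])"
        using that(1-3) actions_right_congruence[OF f] unfolding right_congruence_def by blast
      then show ?thesis using \<open>set x = set y\<close> by (simp add: g_def)
    qed
    show "g x = g y" if "x \<in> lists S" "Tr x y" for x y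
      using act_Tr[OF that] Tr_set_length[OF that(2)] by (simp add: g_def)
    show "set x = set y" if "g x = g y" for x y using that by (simp add: g_def)
  qed
  then have F: "right_congruence S (splits 2 g)" by (rule splits_right_congruence)
  show ?thesis
  proof (rule regular_lang_if_right_congruence[OF F])
    fix x y assume x: "x \<in> {x \<in> lists S. \<forall>u v. Tr x (u @ v) \<longrightarrow> v @ u \<in> K}"
      and y: "y \<in> lists S" and eq: "splits 2 g x = splits 2 g y"
    have "v @ u \<in> K" if tr: "Tr y (u @ v)" for u v
    proof -
      have "map g [u, v] \<in> splits 2 g y" unfolding splits_def using tr by fastforce
      then have "map g [u, v] \<in> splits 2 g x" using eq by simp
      then obtain zs where zs: "map g [u, v] = map g zs" "length zs = 2" "Tr x (concat zs)"
        unfolding splits_def by blast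
      then obtain u' v' where "zs = [u', v']" by (auto simp: length_Suc_conv numeral_2_eq_2)
      then have uv': "g u' = g u" "g v' = g v" "Tr x (u' @ v')" using zs by auto
      have inS: "u \<in> lists S" "v \<in> lists S" "u' \<in> lists S" "v' \<in> lists S"
        using Tr_lists[OF tr] Tr_lists[OF uv'(3)] x y by auto
      have "f (v' @ u') = f (v @ u)"
        using actions_eq_append[OF f inS(4,2,3,1)] uv' by (simp add: g_def)
      moreover have "v' @ u' \<in> K" using x uv'(3) by blast
      ultimately show ?thesis using sat inS by (meson append_in_lists_conv)
    qed
    then show "y \<in> {x \<in> lists S. \<forall>u v. Tr x (u @ v) \<longrightarrow> v @ u \<in> K}" using y by blast
  qed auto
qed

text \<open>Whether a factor from \<open>C\<close> occurs up to commutation is visible in the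
  factorizations into three blocks: the middle block has length at most \<open>N\<close>, so its
  label retains its trace exactly.\<close>

lemma regular_lang_cyclic_factor_avoiding:
  assumes C: "\<And>c. c \<in> C \<Longrightarrow> length c \<le> N"
  shows "regular_lang S {x \<in> lists S. \<forall>u v. Tr x (u @ v) \<longrightarrow>
           v @ u \<in> {w \<in> lists S. \<forall>a c b. Tr w (a @ c @ b) \<longrightarrow> c \<notin> C}}"
proof (rule regular_lang_conjugates)
  show "right_congruence S (splits 3 (short_label N))"
    by (intro splits_right_congruence trace_label_short_label)
  show "splits 3 (short_label N) x = splits 3 (short_label N) y" if "Tr x y" for x y
    using that by (rule splits_Tr)
  fix x y assume x: "x \<in> lists S" and y: "y \<in> lists S"
    and eq: "splits 3 (short_label N) x = splits 3 (short_label N) y"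
    and xK: "x \<in> {w \<in> lists S. \<forall>a c b. Tr w (a @ c @ b) \<longrightarrow> c \<notin> C}"
  have "c \<notin> C" if tr: "Tr y (a @ c @ b)" for a c b
  proof
    assume c: "c \<in> C"
    have "map (short_label N) [a, c, b] \<in> splits 3 (short_label N) y"
      unfolding splits_def using tr by fastforce
    then have "map (short_label N) [a, c, b] \<in> splits 3 (short_label N) x" using eq by simp
    then obtain zs where zs: "map (short_label N) [a, c, b] = map (short_label N) zs"
        "length zs = 3" "Tr x (concat zs)"
      unfolding splits_def by blast
    then obtain a' c' b' where "zs = [a', c', b']" by (auto simp: length_Suc_conv numeral_3_eq_3)
    with zs have sl: "short_label N c = short_label N c'" and tr': "Tr x (a' @ c' @ b')" by simp_all
    have "Tr c' c" by (rule short_label_eqD[OF sl C[OF c]])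
    then have "Tr x (a' @ c @ b')" by (rule Tr_trans[OF tr' Tr_context])
    then show False using xK c by blast
  qed
  then show "y \<in> {w \<in> lists S. \<forall>a c b. Tr w (a @ c @ b) \<longrightarrow> c \<notin> C}" using y by blast
qed

end

section \<open>The geometric representation\<close>

fun alt :: "'a \<Rightarrow> 'a \<Rightarrow> nat \<Rightarrow> 'a list" where
  "alt s t 0 = []"
| "alt s t (Suc n) = s # alt t s n"

lemma length_alt [simp]: "length (alt s t n) = n"
  by (induction s t n rule: alt.induct) auto

lemma set_alt: "set (alt s t n) \<subseteq> {s, t}"
  by (induction s t n rule: alt.induct) auto

lemma alt_add: "alt s t (i + j) = alt s t i @ (if even i then alt s t j else alt t s j)"
  by (induction s t i rule: alt.induct) auto

lemma alt_Suc_right: "alt s t (Suc n) = alt s t n @ [if even n then s else t]"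
  using alt_add[of s t n 1] by simp

lemma rev_alt: "rev (alt s t n) = (if even n then alt t s n else alt s t n)"
proof (induction s t n rule: alt.induct)
  case (2 s t n)
  have "rev (alt s t (Suc n)) = rev (alt t s n) @ [s]" by simp
  also have "\<dots> = (if even n then alt s t n else alt t s n) @ [s]" using 2 by simp
  also have "\<dots> = (if even (Suc n) then alt t s (Suc n) else alt s t (Suc n))"
    by (simp only: alt_Suc_right even_Suc) auto
  finally show ?case .
qed simp

lemma concat_replicate_eq_alt: "concat (replicate k [s, t]) = alt s t (2 * k)"
  by (induction k) auto

text \<open>The recurrence of the Chebyshev polynomials with arbitrary initial values
  \<open>a\<close> and \<open>b\<close>. It governs the coefficients that arise when two reflections
  are applied alternately.\<close>

fun chebyshev_rec :: "real \<Rightarrow> real \<Rightarrow> real \<Rightarrow> nat \<Rightarrow> real" where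
  "chebyshev_rec c a b 0 = a"
| "chebyshev_rec c a b (Suc 0) = b"
| "chebyshev_rec c a b (Suc (Suc j)) = c * chebyshev_rec c a b (Suc j) - chebyshev_rec c a b j"

lemma sin_rec: "sin ((x + 2) * \<theta>) = 2 * cos \<theta> * sin ((x + 1) * \<theta>) - sin (x * \<theta>)" for x \<theta> :: real
proof -
  have "sin ((x + 1) * \<theta> + \<theta>) + sin ((x + 1) * \<theta> - \<theta>) = 2 * cos \<theta> * sin ((x + 1) * \<theta>)"
    by (simp add: sin_add sin_diff)
  then show ?thesis by (simp add: algebra_simps)
qed

text \<open>By \<open>sin_rec\<close> both sides satisfy the same two-step recurrence. The factor
  \<open>sin \<theta>\<close> avoids a division, and \<open>real j - 1\<close> is a real
  subtraction, equal to -1 at \<open>j = 0\<close>.\<close>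

lemma chebyshev_rec_cos:
  "chebyshev_rec (2 * cos \<theta>) a b j * sin \<theta> = b * sin (j * \<theta>) - a * sin ((real j - 1) * \<theta>)"
proof (induction j rule: less_induct)
  case (less j)
  consider "j = 0" | "j = Suc 0" | i where "j = Suc (Suc i)" by (metis not0_implies_Suc)
  then show ?case
  proof cases
    case 3
    have "chebyshev_rec (2 * cos \<theta>) a b j * sin \<theta> =
        2 * cos \<theta> * (chebyshev_rec (2 * cos \<theta>) a b (Suc i) * sin \<theta>) -
        chebyshev_rec (2 * cos \<theta>) a b i * sin \<theta>"
      using 3 by (simp add: algebra_simps)
    also have "\<dots> = 2 * cos \<theta> * (b * sin (Suc i * \<theta>) - a * sin ((real (Suc i) - 1) * \<theta>)) -
        (b * sin (i * \<theta>) - a * sin ((real i - 1) * \<theta>))"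
      using less[of "Suc i"] less[of i] 3 by simp
    also have "\<dots> = b * (2 * cos \<theta> * sin ((real i + 1) * \<theta>) - sin (i * \<theta>))
        - a * (2 * cos \<theta> * sin ((real i - 1 + 1) * \<theta>) - sin ((real i - 1) * \<theta>))"
      by (simp add: algebra_simps)
    also have "\<dots> = b * sin ((real i + 2) * \<theta>) - a * sin ((real i - 1 + 2) * \<theta>)"
      by (simp only: sin_rec)
    also have "\<dots> = b * sin (j * \<theta>) - a * sin ((real j - 1) * \<theta>)"
      using 3 by (simp add: algebra_simps)
    finally show ?thesis .
  qed simp_all
qed

text \<open>Multiplied by \<open>2 * sin \<theta>\<close>, each summand is a difference of
  consecutive cosines, so the sum telescopes.\<close>

lemma sum_sin_even_multiples:
  "(\<Sum>i<k. sin (2 * real i * \<theta> + \<phi>)) * (2 * sin \<theta>) = cos (\<phi> - \<theta>) - cos ((2 * real k - 1) * \<theta> + \<phi>)"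
proof (induction k)
  case (Suc k)
  have "cos (2 * real k * \<theta> + \<phi> - \<theta>) - cos (2 * real k * \<theta> + \<phi> + \<theta>) =
      sin (2 * real k * \<theta> + \<phi>) * (2 * sin \<theta>)"
    by (simp add: cos_add cos_diff)
  moreover have "2 * real k * \<theta> + \<phi> - \<theta> = (2 * real k - 1) * \<theta> + \<phi>"
    "2 * real k * \<theta> + \<phi> + \<theta> = (2 * real (Suc k) - 1) * \<theta> + \<phi>"
    by (simp_all add: algebra_simps)
  ultimately show ?case using Suc by (simp add: distrib_right)
qed simp

text \<open>For \<open>\<theta> = pi / k\<close> the two end terms of the telescoped sum differ by a
  full turn and cancel. This is what makes the \<open>k\<close>-th power of \<open>st\<close> act
  trivially.\<close>

lemma sum_chebyshev_rec_full_period: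
  assumes "k \<ge> 2"
  shows "(\<Sum>i<k. chebyshev_rec (2 * cos (pi / k)) a b (2 * i)) = 0"
    and "(\<Sum>i<k. chebyshev_rec (2 * cos (pi / k)) a b (Suc (2 * i))) = 0"
proof -
  define \<theta> where "\<theta> = pi / k"
  have sin: "sin \<theta> > 0" unfolding \<theta>_def using assms
    by (intro sin_gt_zero) (auto simp: field_simps)
  have k\<theta>: "2 * real k * \<theta> = 2 * pi" using assms by (simp add: \<theta>_def)
  have z: "(\<Sum>i<k. sin (2 * real i * \<theta> + \<phi>)) = 0" for \<phi>
  proof -
    have "(2 * real k - 1) * \<theta> + \<phi> = (\<phi> - \<theta>) + 2 * pi"
      using k\<theta> by (simp add: algebra_simps)
    then have "cos ((2 * real k - 1) * \<theta> + \<phi>) = cos (\<phi> - \<theta>)" by (simp only: cos_periodic)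
    then show ?thesis using sum_sin_even_multiples[of \<theta> \<phi> k] sin by simp
  qed
  let ?g = "chebyshev_rec (2 * cos \<theta>) a b"
  have "(\<Sum>i<k. ?g (2 * i + d)) * sin \<theta> = 0" for d
  proof -
    have "(\<Sum>i<k. ?g (2 * i + d)) * sin \<theta> =
      (\<Sum>i<k. b * sin (2 * real i * \<theta> + d * \<theta>) - a * sin (2 * real i * \<theta> + (real d - 1) * \<theta>))"
      unfolding sum_distrib_right chebyshev_rec_cos
      by (intro sum.cong refl) (simp add: algebra_simps)
    also have "\<dots> = 0" by (simp add: sum_subtractf z flip: sum_distrib_left)
    finally show ?thesis .
  qed
  from this[of 0] this[of 1] sin
  show "(\<Sum>i<k. chebyshev_rec (2 * cos (pi / k)) a b (2 * i)) = 0"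
    and "(\<Sum>i<k. chebyshev_rec (2 * cos (pi / k)) a b (Suc (2 * i))) = 0"
    by (auto simp: \<theta>_def)
qed

lemma sum_lessThan_add: "(\<Sum>i<k + n. f i) = (\<Sum>i<k. f i) + (\<Sum>i<n. f (k + i))"
  for f :: "nat \<Rightarrow> nat"
  by (induction n) auto

section \<open>The Coxeter group as a quotient of words\<close>

locale coxeter_system =
  fixes S :: "'a set" and m :: "'a \<Rightarrow> 'a \<Rightarrow> enat"
  assumes finite_S: "finite S" and cox: "coxeter_matrix S m"
begin

lemma m_sym: "s \<in> S \<Longrightarrow> t \<in> S \<Longrightarrow> m s t = m t s"
  using cox by (auto simp: coxeter_matrix_def)

lemma m_ge_2: "s \<in> S \<Longrightarrow> t \<in> S \<Longrightarrow> s \<noteq> t \<Longrightarrow> m s t = enat k \<Longrightarrow> k \<ge> 2"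
  using cox unfolding coxeter_matrix_def by (metis enat_ord_simps(1) numeral_eq_enat)

abbreviation E :: "'a list \<Rightarrow> 'a list \<Rightarrow> bool" (infix "\<approx>" 50) where
  "x \<approx> y \<equiv> equivclp (rel_step S m) x y"

lemma E_sym: "x \<approx> y \<Longrightarrow> y \<approx> x"
  by (rule equivclp_sym)

lemma E_trans [trans]: "x \<approx> y \<Longrightarrow> y \<approx> z \<Longrightarrow> x \<approx> z"
  by (rule equivclp_trans)

lemma E_invariant:
  assumes "x \<approx> y" and "\<And>x y. rel_step S m x y \<Longrightarrow> h x = h y"
  shows "h x = h y"
  using assms(1)
proof (induction rule: equivclp_induct)
  case (step y z)
  then show ?case using assms(2) by metis
qed simp

lemma E_context: "x \<approx> y \<Longrightarrow> u @ x @ v \<approx> u @ y @ v"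
proof (induction rule: equivclp_induct)
  case (step y z)
  have "rel_step S m (u @ a @ v) (u @ b @ v)" if "rel_step S m a b" for a b
    using that unfolding rel_step_def by (metis append.assoc)
  then have "u @ y @ v \<approx> u @ z @ v" using step(2) by (meson r_into_equivclp equivclp_sym)
  then show ?case using step(3) by (rule E_trans[rotated])
qed simp

lemma E_append: "x \<approx> x' \<Longrightarrow> y \<approx> y' \<Longrightarrow> x @ y \<approx> x' @ y'"
  using E_context[of x x' "[]" y] E_context[of y y' x' "[]"] E_trans by simp

lemma relator_E: "relator S m r \<Longrightarrow> r \<approx> []"
  by (rule r_into_equivclp) (use rel_step_def in force)

text \<open>The generators are involutions, so reversal represents the inverse.\<close>

lemma E_rev: "x \<in> lists S \<Longrightarrow> rev x @ x \<approx> []"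
proof (induction x)
  case (Cons s x)
  then have "[s, s] \<approx> []" by (intro relator_E) (auto simp: relator_def)
  from E_context[OF this, of "rev x" x] have "rev (s # x) @ s # x \<approx> rev x @ x" by simp
  also have "\<dots> \<approx> []" using Cons by simp
  finally show ?case .
qed simp

lemma E_rev': "x \<in> lists S \<Longrightarrow> x @ rev x \<approx> []"
  using E_rev[of "rev x"] by (simp add: in_lists_conv_set)

lemma E_cancel_left:
  assumes "x \<in> lists S" "x @ y \<approx> x @ z"
  shows "y \<approx> z"
proof -
  have "(rev x @ x) @ y \<approx> (rev x @ x) @ z"
    using E_append[OF equivclp_refl assms(2), of "rev x"] by simp
  moreover have "(rev x @ x) @ w \<approx> [] @ w" for w by (intro E_append E_rev assms) simp
  ultimately show ?thesis by (metis E_sym E_trans append_Nil)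
qed

lemma E_move_left:
  assumes "x \<in> lists S"
  shows "x @ y \<approx> z \<longleftrightarrow> y \<approx> rev x @ z"
proof -
  have *: "(rev x @ x) @ y \<approx> [] @ y" "(x @ rev x) @ z \<approx> [] @ z"
    by (rule E_append[OF E_rev[OF assms] equivclp_refl], rule E_append[OF E_rev'[OF assms] equivclp_refl])
  show ?thesis
  proof
    assume "x @ y \<approx> z"
    from E_append[OF equivclp_refl this, of "rev x"] show "y \<approx> rev x @ z"
      using * by (metis E_sym E_trans append_Nil append.assoc)
  next
    assume "y \<approx> rev x @ z"
    from E_append[OF equivclp_refl this, of x] show "x @ y \<approx> z"
      using * by (metis E_trans append_Nil append.assoc)
  qed
qed

lemma E_move_right:
  assumes "x \<in> lists S"
  shows "y @ x \<approx> z \<longleftrightarrow> y \<approx> z @ rev x"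
proof -
  have *: "y @ (x @ rev x) \<approx> y @ []" "z @ (rev x @ x) \<approx> z @ []"
    by (rule E_append[OF equivclp_refl E_rev'[OF assms]], rule E_append[OF equivclp_refl E_rev[OF assms]])
  show ?thesis
  proof
    assume "y @ x \<approx> z"
    from E_append[OF this equivclp_refl, of "rev x"] show "y \<approx> z @ rev x"
      using * by (metis E_sym E_trans append_Nil2 append.assoc)
  next
    assume "y \<approx> z @ rev x"
    from E_append[OF this equivclp_refl, of x] show "y @ x \<approx> z"
      using * by (metis E_trans append_Nil2 append.assoc)
  qed
qed

text \<open>All relators have even length; this is the sign character of the group.\<close>

lemma E_even_length: "x \<approx> y \<Longrightarrow> even (length x) \<longleftrightarrow> even (length y)"
  by (rule E_invariant[where h = "\<lambda>x. even (length x)"])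
    (auto simp: rel_step_def relator_def concat_replicate_eq_alt)

text \<open>The geometric representation, acting on the coordinate functions of the dual space: \<open>reflect f s\<close>
  gives the values of \<open>f\<close> composed with the reflection \<open>s\<close> on the simple roots. It is only needed
  to see that the order of \<open>st\<close> is not smaller than \<open>m s t\<close>.\<close>

definition pairing :: "'a \<Rightarrow> 'a \<Rightarrow> real" where
  "pairing s t = (if s = t then - 2 else case m s t of enat k \<Rightarrow> 2 * cos (pi / k) | \<infinity> \<Rightarrow> 2)"

definition reflect :: "('a \<Rightarrow> real) \<Rightarrow> 'a \<Rightarrow> 'a \<Rightarrow> real" where
  "reflect f s = (\<lambda>u. f u + pairing s u * f s)"

lemma pairing_refl [simp]: "pairing s s = - 2"
  by (simp add: pairing_def)

lemma pairing_sym: "s \<in> S \<Longrightarrow> t \<in> S \<Longrightarrow> pairing s t = pairing t s"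
  by (simp add: pairing_def m_sym)

text \<open>Here \<open>pairing\<close> is -2 times the standard bilinear form, and
  \<open>g j\<close> is the value of the current function at the letter of the next reflection,
  which is the coefficient that this reflection adds. The new value is \<open>c\<close> times the
  last one minus the one before.\<close>

lemma foldl_reflect_alt:
  fixes f :: "'a \<Rightarrow> real"
  assumes "s \<in> S" "t \<in> S"
  defines "c \<equiv> pairing s t"
  defines "g \<equiv> chebyshev_rec c (f s) (f t + c * f s)"
  shows "foldl reflect f (alt s t (2 * k)) = (\<lambda>u. f u
       + pairing s u * (\<Sum>i<k. g (2 * i)) + pairing t u * (\<Sum>i<k. g (Suc (2 * i)))) \<and>
     foldl reflect f (alt s t (2 * k)) s = g (2 * k) \<and>
     foldl reflect f (alt s t (2 * k)) t + c * g (2 * k) = g (Suc (2 * k))"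
proof (induction k)
  case 0
  then show ?case by (simp add: g_def)
next
  case (Suc k)
  define h where "h = foldl reflect f (alt s t (2 * k))"
  have h: "h = (\<lambda>u. f u + pairing s u * (\<Sum>i<k. g (2 * i)) + pairing t u * (\<Sum>i<k. g (Suc (2 * i))))"
    "h s = g (2 * k)"
    using Suc unfolding h_def by blast+
  have ht: "h t = g (Suc (2 * k)) - c * g (2 * k)"
    using Suc unfolding h_def by linarith
  have "2 * Suc k = Suc (Suc (2 * k))" by simp
  then have "alt s t (2 * Suc k) = alt s t (2 * k) @ [s, t]"
    by (simp only: alt_Suc_right) simp
  then have *: "foldl reflect f (alt s t (2 * Suc k)) = reflect (reflect h s) t"
    by (simp add: h_def)
  have **: "reflect (reflect h s) t = (\<lambda>u. h u + pairing s u * g (2 * k) + pairing t u * g (Suc (2 * k)))"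
    by (rule ext) (simp add: reflect_def h(2) ht c_def)
  have g2: "g (2 * Suc k) = c * g (Suc (2 * k)) - g (2 * k)"
    "g (Suc (2 * Suc k)) = c * g (2 * Suc k) - g (Suc (2 * k))"
    by (simp_all add: g_def)
  have "pairing t s = c" using assms pairing_sym by simp
  then have "reflect (reflect h s) t s = g (2 * Suc k)"
    "reflect (reflect h s) t t + c * g (2 * Suc k) = g (Suc (2 * Suc k))"
    unfolding ** g2 by (simp_all add: h(2) ht c_def)
  moreover have "reflect (reflect h s) t = (\<lambda>u. f u
       + pairing s u * (\<Sum>i<Suc k. g (2 * i)) + pairing t u * (\<Sum>i<Suc k. g (Suc (2 * i))))"
    unfolding ** by (subst h(1)) (simp add: algebra_simps)
  ultimately show ?case unfolding * by blast
qed

text \<open>The relators act trivially: a square because \<open>pairing s s\<close> is -2, a braid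
  relator because the two coefficient sums vanish over a full period.\<close>

lemma foldl_reflect_E:
  assumes "x \<approx> y"
  shows "foldl reflect f x = foldl reflect f y"
proof -
  have "foldl reflect h r = h" if "relator S m r" for r h
    using that unfolding relator_def
  proof (elim disjE bexE exE conjE)
    fix s assume "s \<in> S" "r = [s, s]"
    then show ?thesis by (auto simp: reflect_def)
  next
    fix s t k assume *: "s \<in> S" "t \<in> S" "s \<noteq> t" "m s t = enat k" "r = concat (replicate k [s, t])"
    then have "pairing s t = 2 * cos (pi / k)" by (simp add: pairing_def)
    then show ?thesis
      using foldl_reflect_alt[of s t h k] * m_ge_2[of s t k] sum_chebyshev_rec_full_period[of k]
      by (simp add: concat_replicate_eq_alt)
  qed
  then have "foldl reflect f x = foldl reflect f y" if "rel_step S m x y" for x y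
    using that unfolding rel_step_def by auto
  then show ?thesis using assms E_invariant[where h = "foldl reflect f"] by blast
qed

text \<open>A function on the simple roots is exhibited that \<open>k\<close> repetitions of
  \<open>st\<close> do not fix.\<close>

lemma alt_not_E_Nil:
  assumes st: "s \<in> S" "t \<in> S" "s \<noteq> t" and k: "0 < k" "enat k < m s t"
  shows "\<not> alt s t (2 * k) \<approx> []"
proof
  assume E: "alt s t (2 * k) \<approx> []"
  define c where "c = pairing s t"
  show False
  proof (cases "m s t")
    case (enat M)
    define \<theta> where "\<theta> = pi / M"
    have c: "c = 2 * cos \<theta>" using enat st by (simp add: c_def pairing_def \<theta>_def)
    have kM: "k < M" using k enat by simp
    have sin: "sin \<theta> > 0" unfolding \<theta>_def using m_ge_2[OF st enat]
      by (intro sin_gt_zero) (auto simp: field_simps)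
    \<comment> \<open>These initial values give \<open>g j = sin (j * \<theta>)\<close>. If
      \<open>f\<close> were fixed, the angle \<open>2 * k * \<theta>\<close> would have cosine 1,
      which is impossible for \<open>k * \<theta>\<close> strictly between 0 and
      \<open>pi\<close>.\<close>
    define f where "f = (\<lambda>u. if u = t then sin \<theta> else 0)"
    define g where "g = chebyshev_rec c (f s) (f t + c * f s)"
    have g: "g j = sin (j * \<theta>)" for j
      using chebyshev_rec_cos[of \<theta> 0 "sin \<theta>" j] sin st by (simp add: g_def c f_def)
    have fE: "foldl reflect f (alt s t (2 * k)) = f"
      using foldl_reflect_E[OF E, of f] by simp
    have "f s = g (2 * k)" "f t + c * g (2 * k) = g (Suc (2 * k))"
      using foldl_reflect_alt[OF st(1,2), of f k] unfolding fE g_def c_def by blast+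
    then have "sin (2 * k * \<theta>) = 0" "sin \<theta> = sin (2 * k * \<theta> + \<theta>)"
      using st by (simp_all add: g f_def algebra_simps)
    then have "cos (2 * k * \<theta>) = 1" using sin by (simp add: sin_add)
    moreover have "cos (2 * k * \<theta>) = 1 - 2 * (sin (k * \<theta>))\<^sup>2"
      using cos_double_sin[of "k * \<theta>"] by (simp add: mult.assoc)
    moreover have "sin (k * \<theta>) > 0"
      using k kM by (intro sin_gt_zero) (auto simp: \<theta>_def field_simps)
    ultimately show False by simp
  next
    case infinity
    then have c: "c = 2" using st by (simp add: c_def pairing_def)
    \<comment> \<open>For \<open>c = 2\<close> the recurrence produces arithmetic progressions;
      these initial values give \<open>g j = j\<close>, which does not return to 0.\<close>
    define f where "f = (\<lambda>u. if u = t then 1 else 0 :: real)"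
    define g where "g = chebyshev_rec c (f s) (f t + c * f s)"
    have g: "g j = j" for j
      unfolding g_def c using st
      by (induction "2 :: real" "f s" "f t + 2 * f s" j rule: chebyshev_rec.induct) (auto simp: f_def)
    have fE: "foldl reflect f (alt s t (2 * k)) = f"
      using foldl_reflect_E[OF E, of f] by simp
    have "f s = g (2 * k)"
      using foldl_reflect_alt[OF st(1,2), of f k] unfolding fE g_def c_def by blast
    then show False using k st by (simp add: g f_def)
  qed
qed

section \<open>Exchange condition and Matsumoto's theorem\<close>

lemma reduced_iff:
  "reduced S m x \<longleftrightarrow> x \<in> lists S \<and> (\<forall>y\<in>lists S. x \<approx> y \<longrightarrow> length x \<le> length y)"
proof (cases "x \<in> lists S")
  case True
  define P where "P n \<longleftrightarrow> (\<exists>y. same_elem S m x y \<and> length y = n)" for n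
  have cl: "cox_length S m x = Least P" unfolding cox_length_def P_def ..
  have P: "P (length x)" using True by (auto simp: P_def same_elem_def)
  have "length x = Least P \<longleftrightarrow> (\<forall>n. P n \<longrightarrow> length x \<le> n)"
    using P by (metis Least_equality Least_le)
  then show ?thesis
    using True by (auto simp: reduced_def cl P_def same_elem_def)
qed (simp add: reduced_def)

lemma reduced_lists: "reduced S m x \<Longrightarrow> x \<in> lists S"
  by (simp add: reduced_def)

lemma reduced_le: "reduced S m x \<Longrightarrow> x \<approx> y \<Longrightarrow> y \<in> lists S \<Longrightarrow> length x \<le> length y"
  by (simp add: reduced_iff)

lemma reduced_length_eq: "reduced S m x \<Longrightarrow> reduced S m y \<Longrightarrow> x \<approx> y \<Longrightarrow> length x = length y"
  using reduced_le reduced_lists E_sym by (metis le_antisym)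

lemma reduced_transfer:
  assumes "reduced S m x" "x \<approx> y" "y \<in> lists S" "length y \<le> length x"
  shows "reduced S m y"
  unfolding reduced_iff
proof (intro conjI ballI impI)
  fix z assume "z \<in> lists S" "y \<approx> z"
  then show "length y \<le> length z" using assms reduced_le E_trans by (meson le_trans)
qed (rule assms)

lemma reduced_exists:
  assumes "x \<in> lists S"
  obtains y where "reduced S m y" "x \<approx> y"
proof -
  obtain y where y: "x \<approx> y \<and> y \<in> lists S" and min: "\<And>z. x \<approx> z \<and> z \<in> lists S \<Longrightarrow> length y \<le> length z"
    using ex_has_least_nat[of "\<lambda>y. x \<approx> y \<and> y \<in> lists S" x length] assms equivclp_refl by metis
  have "reduced S m y"
    unfolding reduced_iff using y min E_trans by blast
  then show ?thesis using that y by blast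
qed

lemma reduced_factor:
  assumes "reduced S m (u @ x @ v)"
  shows "reduced S m x"
  unfolding reduced_iff
proof (intro conjI ballI impI)
  fix y assume "y \<in> lists S" "x \<approx> y"
  then have "length (u @ x @ v) \<le> length (u @ y @ v)"
    using assms reduced_lists[OF assms] by (intro reduced_le E_context) auto
  then show "length x \<le> length y" by simp
qed (use reduced_lists[OF assms] in simp)

lemma E_square: "s \<in> S \<Longrightarrow> [s, s] \<approx> []"
  by (intro relator_E) (auto simp: relator_def)

lemma not_reduced_square: "s \<in> S \<Longrightarrow> \<not> reduced S m (u @ [s, s] @ v)"
  using reduced_factor[of u "[s, s]" v] reduced_le[OF _ E_square] by fastforce

lemma alt_E_swap_iff:
  assumes "s \<in> S" "t \<in> S"
  shows "alt s t n \<approx> alt t s n \<longleftrightarrow> alt s t (2 * n) \<approx> []"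
proof -
  have "rev (alt t s n) \<in> lists S" using set_alt[of t s n] assms by auto
  moreover have "alt s t (2 * n) = alt s t n @ rev (alt t s n)"
    using alt_add[of s t n n] by (simp add: rev_alt mult_2)
  ultimately show ?thesis using E_move_right[of "rev (alt t s n)" "alt s t n" "[]"] by simp
qed

text \<open>The parity of the number of prefixes \<open>p @ [s]\<close> of the word for which the reflection
  \<open>p @ [s] @ rev p\<close> equals \<open>r\<close>; it depends only on the group element.\<close>

fun crossing_parity :: "'a list \<Rightarrow> 'a list \<Rightarrow> bool" where
  "crossing_parity [] r = False"
| "crossing_parity (s # x) r = (([s] \<approx> r) \<noteq> crossing_parity x (s # r @ [s]))"

lemma crossing_parity_cong: "r \<approx> r' \<Longrightarrow> crossing_parity x r = crossing_parity x r'"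
proof (induction x arbitrary: r r')
  case (Cons s x)
  then have "crossing_parity x (s # r @ [s]) = crossing_parity x (s # r' @ [s])"
    using E_context[of r r' "[s]" "[s]"] by simp
  moreover have "[s] \<approx> r \<longleftrightarrow> [s] \<approx> r'" using Cons.prems E_sym E_trans by blast
  ultimately show ?case by simp
qed simp

text \<open>A cocycle rule: the prefix reflections inside \<open>y\<close> are conjugated by
  \<open>x\<close>, which is compensated by conjugating \<open>r\<close> the other way.\<close>

lemma crossing_parity_append:
  "crossing_parity (x @ y) r = (crossing_parity x r \<noteq> crossing_parity y (rev x @ r @ x))"
  by (induction x arbitrary: r) auto

text \<open>The prefix reflections of an alternating word are the alternating words of odd length
  with the same first letter.\<close>

lemma crossing_parity_alt:
  assumes "s \<in> S" "t \<in> S"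
  shows "crossing_parity (alt s t n) r \<longleftrightarrow> odd (\<Sum>i<n. of_bool (alt s t (2 * i + 1) \<approx> r) :: nat)"
proof (induction n)
  case (Suc n)
  define u where "u = (if even n then s else t)"
  define A where "A = alt s t n"
  have A: "A \<in> lists S" using set_alt[of s t n] assms by (auto simp: A_def)
  have "[u] \<approx> rev A @ r @ A \<longleftrightarrow> r @ A \<approx> A @ [u]"
    using E_move_left[OF A, of "[u]" "r @ A"] E_sym by blast
  also have "\<dots> \<longleftrightarrow> A @ [u] @ rev A \<approx> r"
    using E_move_right[OF A, of r "A @ [u]"] E_sym by auto
  also have "A @ [u] @ rev A = alt s t (2 * n + 1)"
    using alt_add[of s t n "Suc n"] by (auto simp: A_def u_def rev_alt mult_2)
  finally have "[u] \<approx> rev A @ r @ A \<longleftrightarrow> alt s t (2 * n + 1) \<approx> r" .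
  moreover have "alt s t (Suc n) = A @ [u]" by (simp only: alt_Suc_right A_def u_def)
  ultimately show ?case using Suc by (simp add: crossing_parity_append flip: A_def)
qed simp

text \<open>Both prefix reflections of \<open>[s, s]\<close> equal \<open>s\<close>, and the
  \<open>2 * k\<close> prefix reflections of a braid relator repeat with period \<open>k\<close>;
  every reflection is therefore met an even number of times.\<close>

lemma crossing_parity_relator:
  assumes "relator S m w"
  shows "\<not> crossing_parity w r"
  using assms unfolding relator_def
proof (elim disjE bexE exE conjE)
  fix s assume s: "s \<in> S" and w: "w = [s, s]"
  have *: "[s] @ (s # r) \<approx> r" "(s # r @ [s]) @ [s] \<approx> s # r"
    using E_append[OF E_square[OF s] equivclp_refl, of r]
      E_append[OF equivclp_refl E_square[OF s], of "s # r"] by simp_all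
  have "[s] \<approx> s # r @ [s] \<longleftrightarrow> [s] @ [s] \<approx> s # r"
    using E_move_right[of "[s]" "[s]" "s # r"] s by simp
  also have "\<dots> \<longleftrightarrow> [s] \<approx> [s] @ (s # r)"
    using E_move_left[of "[s]" "[s]" "s # r"] s by simp
  also have "\<dots> \<longleftrightarrow> [s] \<approx> r" using *(1) E_sym E_trans by blast
  finally show ?thesis using w by simp
next
  fix s t k assume *: "s \<in> S" "t \<in> S" "s \<noteq> t" "m s t = enat k" "w = concat (replicate k [s, t])"
  then have E: "alt s t (2 * k) \<approx> []" using relator_E[OF assms] by (simp add: concat_replicate_eq_alt)
  define b :: "nat \<Rightarrow> nat" where "b i = of_bool (alt s t (2 * i + 1) \<approx> r)" for i
  have "b (k + i) = b i" for i
  proof -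
    have "alt s t (2 * (k + i) + 1) = alt s t (2 * k) @ alt s t (2 * i + 1)"
      using alt_add[of s t "2 * k" "2 * i + 1"] by (simp add: algebra_simps)
    then have "alt s t (2 * (k + i) + 1) \<approx> alt s t (2 * i + 1)"
      using E_append[OF E equivclp_refl, of "alt s t (2 * i + 1)"] by simp
    then have "alt s t (2 * (k + i) + 1) \<approx> r \<longleftrightarrow> alt s t (2 * i + 1) \<approx> r" using E_sym E_trans by blast
    then show ?thesis by (simp only: b_def)
  qed
  then have "(\<Sum>i<2 * k. b i) = 2 * (\<Sum>i<k. b i)"
    using sum_lessThan_add[of b k k] by (simp add: mult_2)
  then have "even (\<Sum>i<2 * k. b i)" by simp
  then show ?thesis
    using crossing_parity_alt[OF *(1,2), of "2 * k" r] * by (simp only: b_def concat_replicate_eq_alt) simp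
qed

lemma crossing_parity_E:
  assumes "x \<approx> y"
  shows "crossing_parity x r = crossing_parity y r"
proof -
  have "crossing_parity x r = crossing_parity y r" if "rel_step S m x y" for x y r
  proof -
    from that obtain u v w where w: "relator S m w" and xy: "x = u @ w @ v" "y = u @ v"
      unfolding rel_step_def by blast
    have E: "w \<approx> []" by (rule relator_E[OF w])
    have "w \<in> lists S" using w set_alt unfolding relator_def concat_replicate_eq_alt by fastforce
    then have "rev w @ w \<approx> []" by (rule E_rev)
    moreover have "rev w @ w \<approx> rev w @ []" by (intro E_append E equivclp_refl)
    ultimately have "rev w \<approx> []" using E_sym E_trans by (metis append_Nil2)
    then have "rev w @ (rev u @ r @ u) @ w \<approx> [] @ (rev u @ r @ u) @ []"
      by (intro E_append E equivclp_refl)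
    then show ?thesis
      using crossing_parity_relator[OF w] crossing_parity_cong
      unfolding xy crossing_parity_append by simp
  qed
  then have "crossing_parity x = crossing_parity y"
    by (intro E_invariant[OF assms]) blast
  then show ?thesis by simp
qed

lemma crossing_parityD:
  "crossing_parity x r \<Longrightarrow> x \<in> lists S \<Longrightarrow> \<exists>p s q. x = p @ s # q \<and> p @ [s] @ rev p \<approx> r"
proof (induction x arbitrary: r)
  case (Cons a x)
  show ?case
  proof (cases "[a] \<approx> r")
    case True
    then have "a # x = [] @ a # x \<and> [] @ [a] @ rev [] \<approx> r" by simp
    then show ?thesis by blast
  next
    case False
    then have "crossing_parity x (a # r @ [a])" using Cons.prems(1) by simp
    moreover have "x \<in> lists S" using Cons.prems(2) by simp
    ultimately obtain p s q where x: "x = p @ s # q" and E: "p @ [s] @ rev p \<approx> a # r @ [a]"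
      using Cons.IH by blast
    have a: "[a] \<in> lists S" using Cons.prems(2) by simp
    have "p @ [s] @ rev p \<approx> rev [a] @ (r @ [a])" using E by simp
    then have "[a] @ p @ [s] @ rev p \<approx> r @ rev [a]" using E_move_left[OF a] by simp
    then have "([a] @ p @ [s] @ rev p) @ [a] \<approx> r" using E_move_right[OF a] by blast
    then have "a # x = (a # p) @ s # q \<and> (a # p) @ [s] @ rev (a # p) \<approx> r" using x by simp
    then show ?thesis by blast
  qed
qed simp

text \<open>In \<open>t # y\<close> the reflection \<open>t\<close> is crossed an odd number of
  times, and this parity is shared by every word for the same element. Hence some prefix reflection
  of \<open>x\<close> equals \<open>t\<close>.\<close>

lemma exchange:
  assumes x: "reduced S m x" and y: "reduced S m (t # y)" and E: "x \<approx> t # y"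
  obtains p s q where "x = p @ s # q" "t # p \<approx> p @ [s]"
proof -
  have conj: "t # p \<approx> p @ [s]" if "p @ [s] @ rev p \<approx> [t]" "p \<in> lists S" for p s
    using E_move_right[of "rev p" "p @ [s]" "[t]"] that E_sym by (auto simp: in_lists_conv_set)
  have t: "t \<in> S" "y \<in> lists S" using reduced_lists[OF y] by auto
  \<comment> \<open>A further crossing of \<open>t\<close> inside \<open>y\<close> would allow two
    letters of \<open>t # y\<close> to be deleted.\<close>
  have "\<not> crossing_parity y [t]"
  proof
    assume "crossing_parity y [t]"
    then obtain p s q where y': "y = p @ s # q" "p @ [s] @ rev p \<approx> [t]"
      using crossing_parityD t(2) by blast
    then have "t # p \<approx> p @ [s]" using conj t(2) by simp
    from E_append[OF E_sym[OF this] equivclp_refl, of q] have "y \<approx> [t] @ (p @ q)" using y' by simp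
    then have "t # y \<approx> p @ q" using E_move_left[of "[t]" y "p @ q"] t by simp
    then show False using reduced_le[OF y] y'(1) t(2) by fastforce
  qed
  moreover have "[t, t, t] \<approx> [t]" using E_append[OF E_square equivclp_refl, of t "[t]"] t by simp
  ultimately have "crossing_parity (t # y) [t]" using crossing_parity_cong by auto
  then have "crossing_parity x [t]" using crossing_parity_E[OF E] by simp
  then obtain p s q where "x = p @ s # q" "p @ [s] @ rev p \<approx> [t]"
    using crossing_parityD reduced_lists[OF x] by blast
  then show ?thesis using that conj reduced_lists[OF x] by auto
qed

text \<open>The induction alternates between the two letters: from a prefix
  \<open>alt t s j\<close>, exchange brings \<open>s\<close> to the front at the cost of one letter.
  That letter lies beyond the alternating prefix, which therefore grows by one.\<close>

lemma two_descents_alt_prefix: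
  assumes "reduced S m (s # x)" "reduced S m (t # y)" "s # x \<approx> t # y" "s \<noteq> t" "enat j \<le> m s t"
  shows "\<exists>z. reduced S m (alt s t j @ z) \<and> alt s t j @ z \<approx> s # x"
  using assms
proof (induction j arbitrary: s t x y)
  case 0
  then show ?case by force
next
  case (Suc j)
  have st: "s \<in> S" "t \<in> S" using Suc.prems(1,2)[THEN reduced_lists] by auto
  have j: "enat j < m s t" using Suc.prems(5) by (metis Suc_ile_eq)
  then have "enat j \<le> m t s" using m_sym[OF st] by simp
  then obtain z where z: "reduced S m (alt t s j @ z)" "alt t s j @ z \<approx> t # y"
    using Suc.IH[OF Suc.prems(2,1) E_sym] Suc.prems(3,4) by blast
  have E: "alt t s j @ z \<approx> s # x" using z(2) Suc.prems(3) E_sym E_trans by blast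
  from exchange[OF z(1) Suc.prems(1) E]
  obtain p r q where p: "alt t s j @ z = p @ r # q" "s # p \<approx> p @ [r]" .
  show ?case
  proof (cases "length p < j")
    \<comment> \<open>Deleting a letter inside the alternating prefix would yield a braid relation
      of length at most \<open>j\<close>, hence below \<open>m s t\<close>, against the order of
      \<open>st\<close>.\<close>
    case True
    define i where "i = length p"
    have "take i (alt t s j @ z) = p" "take (Suc i) (alt t s j @ z) = p @ [r]"
      unfolding p(1) by (simp_all add: i_def)
    moreover have "take k (alt t s j @ z) = alt t s k" if "k \<le> j" for k
      using alt_add[of t s k "j - k"] that by simp
    ultimately have "p = alt t s i" "p @ [r] = alt t s (Suc i)" using True by (auto simp: i_def)
    then have "alt s t (Suc i) \<approx> alt t s (Suc i)" using p(2) by simp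
    then have "alt s t (2 * Suc i) \<approx> []" using alt_E_swap_iff[OF st] by blast
    moreover have "enat (Suc i) < m s t"
      using j True by (metis Suc_leI enat_ord_simps(1) i_def order.strict_trans1)
    ultimately show ?thesis using alt_not_E_Nil[OF st Suc.prems(4)] by blast
  next
    case False
    define p' where "p' = drop j p"
    have "take j (alt t s j @ z) = take j p" unfolding p(1) using False by simp
    then have p'1: "p = alt t s j @ p'" unfolding p'_def by (metis append_take_drop_id append_eq_conv_conj length_alt)
    then have "z = p' @ r # q" using p(1) by simp
    note p' = p'1 this
    from E_append[OF p(2) equivclp_refl, of q]
    have E': "alt s t (Suc j) @ p' @ q \<approx> alt t s j @ z" using p' by simp
    have "reduced S m (alt s t (Suc j) @ p' @ q)"
      using reduced_lists[OF z(1)] st p' set_alt[of s t "Suc j"]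
      by (intro reduced_transfer[OF z(1) E_sym[OF E']]) auto
    then show ?thesis using E' E E_trans by blast
  qed
qed

section \<open>Braid moves and the word problem\<close>

definition braid :: "'a list \<Rightarrow> 'a list \<Rightarrow> bool" where
  "braid x y \<longleftrightarrow> (\<exists>u v s t k. s \<in> S \<and> t \<in> S \<and> s \<noteq> t \<and> m s t = enat k \<and>
     x = u @ alt s t k @ v \<and> y = u @ alt t s k @ v)"

lemma braid_E: "braid x y \<Longrightarrow> x \<approx> y"
  unfolding braid_def
proof (elim exE conjE)
  fix u v s t k assume *: "s \<in> S" "t \<in> S" "s \<noteq> t" "m s t = enat k"
    "x = u @ alt s t k @ v" "y = u @ alt t s k @ v"
  have "alt s t (2 * k) \<approx> []"
    using * by (intro relator_E) (auto simp: relator_def simp flip: concat_replicate_eq_alt)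
  then show ?thesis using * alt_E_swap_iff E_context by blast
qed

lemma braids_E: "braid\<^sup>*\<^sup>* x y \<Longrightarrow> x \<approx> y"
proof (induction rule: rtranclp_induct)
  case (step y z)
  then show ?case using braid_E E_trans by blast
qed simp

lemma braid_sym: "braid x y \<Longrightarrow> braid y x"
  unfolding braid_def using m_sym by metis

lemma braids_append:
  assumes "braid\<^sup>*\<^sup>* x y"
  shows "braid\<^sup>*\<^sup>* (u @ x) (u @ y)"
  using assms
proof (induction rule: rtranclp_induct)
  case (step y z)
  have "braid (u @ y) (u @ z)" using step(2) unfolding braid_def by (metis append.assoc)
  then show ?case using step(3) by simp
qed simp

text \<open>Induction on the length. A common first letter can be cancelled. For distinct first
  letters \<open>s\<close> and \<open>t\<close> there is a reduced word for the same element
  starting with the full alternating word of length \<open>m s t\<close>; it shares its first letter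
  with \<open>x\<close>, and after one braid move with \<open>y\<close>. An infinite
  \<open>m s t\<close> would give alternating prefixes longer than \<open>x\<close>.\<close>

lemma matsumoto:
  "reduced S m x \<Longrightarrow> reduced S m y \<Longrightarrow> x \<approx> y \<Longrightarrow> braid\<^sup>*\<^sup>* x y"
proof (induction "length x" arbitrary: x y)
  case 0
  then have "x = []" "y = []" using reduced_length_eq[OF 0(2-4)] by auto
  then show ?case by simp
next
  case (Suc n)
  have same: "braid\<^sup>*\<^sup>* (s # x) (s # y)"
    if "reduced S m (s # x)" "reduced S m (s # y)" "s # x \<approx> s # y" "length (s # x) = Suc n" for s x y
  proof -
    have "s \<in> S" using reduced_lists[OF that(1)] by simp
    then have "x \<approx> y" using E_cancel_left[of "[s]" x y] that(3) by simp
    then have "braid\<^sup>*\<^sup>* x y"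
      using Suc.hyps(1)[of x y] that reduced_factor[of "[s]" _ "[]"] by simp
    then show ?thesis using braids_append[of x y "[s]"] by simp
  qed
  obtain s x' where x: "x = s # x'" using Suc.hyps(2) by (cases x) auto
  have len: "length y = Suc n" using reduced_length_eq[OF Suc.prems] Suc.hyps(2) by simp
  then obtain t y' where y: "y = t # y'" by (cases y) auto
  show ?case
  proof (cases "s = t")
    case True
    then show ?thesis using same x y Suc.prems Suc.hyps(2) by simp
  next
    case False
    have st: "s \<in> S" "t \<in> S" using Suc.prems(1,2)[THEN reduced_lists] x y by auto
    have red: "reduced S m (s # x')" "reduced S m (t # y')" "s # x' \<approx> t # y'"
      using Suc.prems x y by auto
    note prefix = two_descents_alt_prefix[OF red False]
    obtain k where k: "m s t = enat k"
    proof (cases "m s t")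
      case infinity
      then obtain z where "reduced S m (alt s t (Suc (length x)) @ z)" "alt s t (Suc (length x)) @ z \<approx> x"
        using prefix[of "Suc (length x)"] x by auto
      from reduced_length_eq[OF this(1) Suc.prems(1) this(2)] show ?thesis by simp
    qed (rule that)
    obtain z where z: "reduced S m (alt s t k @ z)" "alt s t k @ z \<approx> x" using prefix[of k] k x by auto
    obtain k' where k': "k = Suc k'" using m_ge_2[OF st False k] by (cases k) auto
    have b: "braid (alt s t k @ z) (alt t s k @ z)"
      unfolding braid_def using st False k by (metis append_Nil)
    have E: "alt t s k @ z \<approx> y" using braid_E[OF braid_sym[OF b]] z(2) Suc.prems(3) E_trans by blast
    have "alt t s k @ z \<in> lists S" using reduced_lists[OF z(1)] st set_alt[of t s k] by auto
    then have red': "reduced S m (alt t s k @ z)"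
      by (intro reduced_transfer[OF z(1) braid_E[OF b]]) auto
    have "braid\<^sup>*\<^sup>* x (alt s t k @ z)"
      using same[of s x' "alt t s k' @ z"] z Suc.hyps(2) Suc.prems(1) E_sym x k' by simp
    also have "braid (alt s t k @ z) (alt t s k @ z)" by (rule b)
    also have "braid\<^sup>*\<^sup>* (alt t s k @ z) y"
      using same[of t "alt s t k' @ z" y'] red' E Suc.prems(2) reduced_length_eq[OF red' Suc.prems(2) E]
        len y k' by simp
    finally show ?thesis .
  qed
qed

text \<open>This half of Tits' solution of the word problem follows by looking at the shortest
  nonreduced suffix \<open>a # x\<close>: there \<open>x\<close> has a reduced expression beginning
  with \<open>a\<close>, which braid moves reach.\<close>

lemma nonreduced_braids_square:
  "x \<in> lists S \<Longrightarrow> \<not> reduced S m x \<Longrightarrow> \<exists>u s v. s \<in> S \<and> braid\<^sup>*\<^sup>* x (u @ [s, s] @ v)"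
proof (induction x)
  case Nil
  then show ?case by (simp add: reduced_iff)
next
  case (Cons a x)
  have a: "a \<in> S" "x \<in> lists S" using Cons.prems by auto
  show ?case
  proof (cases "reduced S m x")
    case False
    then obtain u s v where "s \<in> S" "braid\<^sup>*\<^sup>* x (u @ [s, s] @ v)" using Cons.IH a by blast
    then have "s \<in> S \<and> braid\<^sup>*\<^sup>* (a # x) ((a # u) @ [s, s] @ v)" using braids_append[of x _ "[a]"] by simp
    then show ?thesis by blast
  next
    case True
    obtain r where r: "reduced S m r" "a # x \<approx> r" using reduced_exists[OF Cons.prems(1)] .
    have "length r \<le> length (a # x)" using reduced_le[OF r(1) E_sym[OF r(2)] Cons.prems(1)] .
    moreover have "length r \<noteq> length (a # x)"
      using reduced_transfer[OF r(1) E_sym[OF r(2)] Cons.prems(1)] Cons.prems(2) by auto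
    \<comment> \<open>Parity rules out \<open>length r = length x\<close>, so passing from
      \<open>x\<close> to \<open>a # x\<close> shortens the element by one.\<close>
    moreover have "even (length r) \<longleftrightarrow> even (length (a # x))" using E_even_length[OF r(2)] by simp
    ultimately have len: "length (a # r) \<le> length x" by (cases "length r = length x") auto
    have E: "x \<approx> a # r" using E_move_left[of "[a]" x r] r(2) a by simp
    have "reduced S m (a # r)"
      using reduced_transfer[OF True E _ len] a reduced_lists[OF r(1)] by simp
    from matsumoto[OF True this E] have "braid\<^sup>*\<^sup>* (a # x) ([] @ [a, a] @ r)"
      using braids_append[of x _ "[a]"] by simp
    then show ?thesis using a by blast
  qed
qed

section \<open>Fully commutative elements\<close>

text \<open>Independence asks for distinct letters of \<open>S\<close> because \<open>m\<close> is
  unconstrained on the diagonal and outside \<open>S\<close>.\<close>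

sublocale trace_alphabet S "\<lambda>s t. s \<in> S \<and> t \<in> S \<and> s \<noteq> t \<and> m s t = 2"
  by standard (use finite_S m_sym in auto)

lemma swap_braid: "swap x y \<Longrightarrow> braid x y"
  unfolding swap_def braid_def
proof (elim exE conjE)
  fix u v s t assume *: "s \<in> S" "t \<in> S" "s \<noteq> t" "m s t = 2" "x = u @ [s, t] @ v" "y = u @ [t, s] @ v"
  then have "m s t = enat 2" "x = u @ alt s t 2 @ v" "y = u @ alt t s 2 @ v"
    by (simp_all add: numeral_2_eq_2 numeral_eq_enat)
  then show "\<exists>u v s t k. s \<in> S \<and> t \<in> S \<and> s \<noteq> t \<and> m s t = enat k \<and>
     x = u @ alt s t k @ v \<and> y = u @ alt t s k @ v" using * by blast
qed

lemma Tr_E: "Tr x y \<Longrightarrow> x \<approx> y"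
proof -
  assume "Tr x y"
  moreover have "swap \<le> braid" using swap_braid by blast
  ultimately have "braid\<^sup>*\<^sup>* x y" unfolding Tr_def using rtranclp_mono by blast
  then show ?thesis by (rule braids_E)
qed

lemma Tr_comm_step: "Tr x y \<Longrightarrow> (comm_step m)\<^sup>*\<^sup>* x y"
proof -
  have "swap \<le> comm_step m" unfolding swap_def comm_step_def by blast
  then show "Tr x y \<Longrightarrow> (comm_step m)\<^sup>*\<^sup>* x y" unfolding Tr_def using rtranclp_mono by blast
qed

definition forbidden :: "'a list set" where
  "forbidden = {[s, s] | s. s \<in> S} \<union>
     {alt s t k | s t k. s \<in> S \<and> t \<in> S \<and> s \<noteq> t \<and> m s t = enat k \<and> k \<ge> 3}"

definition avoiding :: "'a list set" where
  "avoiding = {w \<in> lists S. \<forall>a c b. Tr w (a @ c @ b) \<longrightarrow> c \<notin> forbidden}"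

lemma forbidden_length_bounded: "\<exists>N. \<forall>c\<in>forbidden. length c \<le> N"
proof -
  \<comment> \<open>Infinite entries yield no forbidden word; whatever value \<open>the_enat\<close>
    assigns to them, the image stays finite.\<close>
  have "finite ((\<lambda>(s, t). the_enat (m s t)) ` (S \<times> S))" using finite_S by simp
  then obtain N where N: "\<And>s t. s \<in> S \<Longrightarrow> t \<in> S \<Longrightarrow> the_enat (m s t) \<le> N"
    unfolding finite_nat_set_iff_bounded_le by auto
  have "length c \<le> max 2 N" if "c \<in> forbidden" for c
    using that N unfolding forbidden_def by (fastforce simp: le_max_iff_disj)
  then show ?thesis by blast
qed

text \<open>No word in the commutation class admits a braid move of length at least 3, so every move
  that applies is a commutation and stays in the class.\<close>

lemma avoiding_braids:
  assumes "x \<in> avoiding" "braid\<^sup>*\<^sup>* x y"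
  shows "Tr x y"
  using assms(2)
proof (induction rule: rtranclp_induct)
  case (step y z)
  from step(2) obtain u v s t k where *: "s \<in> S" "t \<in> S" "s \<noteq> t" "m s t = enat k"
    "y = u @ alt s t k @ v" "z = u @ alt t s k @ v" unfolding braid_def by blast
  then have "alt s t k \<notin> forbidden" using step(3) assms(1) unfolding avoiding_def by blast
  then have "\<not> k \<ge> 3" using * unfolding forbidden_def by blast
  then have "k = 2" using m_ge_2[OF *(1-4)] by simp
  then have "swap y z" unfolding swap_def using * by (auto simp: numeral_2_eq_2 numeral_eq_enat)
  then show ?case using step(3) unfolding Tr_def by simp
qed simp

text \<open>A nonreduced word reaches a square by braid moves. Here these are commutations, and
  squares are forbidden.\<close>

lemma avoiding_imp_reduced:
  assumes "x \<in> avoiding"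
  shows "reduced S m x"
proof (rule ccontr)
  assume "\<not> reduced S m x"
  then obtain u s v where s: "s \<in> S" "braid\<^sup>*\<^sup>* x (u @ [s, s] @ v)"
    using nonreduced_braids_square assms unfolding avoiding_def by blast
  then have "[s, s] \<notin> forbidden" using avoiding_braids[OF assms] assms unfolding avoiding_def by blast
  then show False using s unfolding forbidden_def by blast
qed

lemma Tr_reduced:
  assumes red: "reduced S m x" and tr: "Tr x y"
  shows "reduced S m y"
proof (rule reduced_transfer[OF red Tr_E[OF tr]])
  show "y \<in> lists S" using Tr_lists[OF tr] reduced_lists[OF red] by blast
  show "length y \<le> length x" using Tr_set_length[OF tr] by simp
qed

lemma avoiding_red_exprs:
  assumes "x \<in> avoiding"
  shows "red_exprs S m x = {y. Tr x y}"
proof -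
  have x: "reduced S m x" by (rule avoiding_imp_reduced[OF assms])
  have "Tr x y" if "reduced S m y" "same_elem S m x y" for y
    using matsumoto[OF x that(1)] that(2) avoiding_braids[OF assms] unfolding same_elem_def by blast
  moreover have "same_elem S m x y" if "Tr x y" for y
    using reduced_lists[OF x] that Tr_lists Tr_E unfolding same_elem_def by blast
  ultimately show ?thesis using Tr_reduced[OF x] unfolding red_exprs_def by blast
qed

text \<open>The projection to two letters that do not commute is an invariant of commutation; it
  tells the two sides of a long braid move apart.\<close>

lemma comm_step_filter:
  assumes "(comm_step m)\<^sup>*\<^sup>* x y" "m s t \<noteq> 2" "m t s \<noteq> 2"
  shows "filter (\<lambda>a. a = s \<or> a = t) x = filter (\<lambda>a. a = s \<or> a = t) y"
  using assms(1)
proof (induction rule: rtranclp_induct)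
  case (step y z)
  then obtain u v a b where ab: "m a b = 2" "y = u @ [a, b] @ v" "z = u @ [b, a] @ v"
    unfolding comm_step_def by blast
  then have "filter (\<lambda>a. a = s \<or> a = t) [a, b] = filter (\<lambda>a. a = s \<or> a = t) [b, a]"
    using assms(2,3) by auto
  then show ?case using step(3) unfolding ab(2,3) filter_append by argo
qed simp

text \<open>An avoiding word has its commutation class as its set of reduced expressions.
  Conversely, a square contradicts reducedness, and a long braid factor leads to a reduced
  expression with a different projection to its two letters.\<close>

lemma avoiding_iff: "x \<in> avoiding \<longleftrightarrow> reduced S m x \<and> fully_commutative S m x"
proof
  assume x: "x \<in> avoiding"
  have "(comm_step m)\<^sup>*\<^sup>* y z" if "Tr x y" "Tr x z" for y z
    using Tr_comm_step[OF Tr_trans[OF Tr_sym[OF that(1)] that(2)]] .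
  then show "reduced S m x \<and> fully_commutative S m x"
    using avoiding_imp_reduced[OF x] unfolding fully_commutative_def avoiding_red_exprs[OF x] by blast
next
  assume x: "reduced S m x \<and> fully_commutative S m x"
  have "c \<notin> forbidden" if tr: "Tr x (a @ c @ b)" for a c b
  proof
    assume c: "c \<in> forbidden"
    have red: "reduced S m (a @ c @ b)" using Tr_reduced x tr by blast
    from c consider s where "s \<in> S" "c = [s, s]"
      | s t k where "s \<in> S" "t \<in> S" "s \<noteq> t" "m s t = enat k" "k \<ge> 3" "c = alt s t k"
      unfolding forbidden_def by blast
    then show False
    proof cases
      case 1
      then show ?thesis using not_reduced_square red by blast
    next
      case 2
      have b: "braid (a @ c @ b) (a @ alt t s k @ b)" unfolding braid_def using 2 by blast
      have "a @ alt t s k @ b \<in> lists S" using reduced_lists[OF red] 2 set_alt[of t s k] by auto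
      then have red': "reduced S m (a @ alt t s k @ b)"
        using 2 by (intro reduced_transfer[OF red braid_E[OF b]]) auto
      have "a @ c @ b \<in> red_exprs S m x" "a @ alt t s k @ b \<in> red_exprs S m x"
        using red red' x reduced_lists Tr_E[OF tr] E_trans[OF Tr_E[OF tr] braid_E[OF b]]
        unfolding red_exprs_def same_elem_def by blast+
      then have "(comm_step m)\<^sup>*\<^sup>* (a @ c @ b) (a @ alt t s k @ b)"
        using x unfolding fully_commutative_def by blast
      moreover have "m s t \<noteq> 2" "m t s \<noteq> 2" using 2 m_sym[of s t] by (auto simp: numeral_eq_enat)
      ultimately have "filter (\<lambda>a. a = s \<or> a = t) (a @ c @ b) = filter (\<lambda>a. a = s \<or> a = t) (a @ alt t s k @ b)"
        using comm_step_filter by blast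
      moreover have "filter (\<lambda>a. a = s \<or> a = t) (alt s t k) = alt s t k"
        "filter (\<lambda>a. a = s \<or> a = t) (alt t s k) = alt t s k"
        using set_alt[of s t k] set_alt[of t s k] by (auto intro!: filter_True)
      \<comment> \<open>The projections of \<open>a\<close> and \<open>b\<close> cancel on both
        sides; what remains are nonempty words with different first letters.\<close>
      ultimately have "alt s t k = alt t s k" using 2 by simp
      then show ?thesis using 2 by (cases k) auto
    qed
  qed
  then show "x \<in> avoiding" using x reduced_lists unfolding avoiding_def by blast
qed

section \<open>Cyclic shifts\<close>

text \<open>Once \<open>x\<close> is known to be avoiding, its reduced expressions are its
  commutation class, and their rotations are the words \<open>v @ u\<close> for factorizations
  \<open>u @ v\<close>. The trivial rotation, or the empty \<open>u\<close>, shows that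
  \<open>x\<close> is avoiding.\<close>

lemma cyc_fully_commutative_iff:
  "{x. reduced S m x \<and> cyc_fully_commutative S m x} =
   {x \<in> lists S. \<forall>u v. Tr x (u @ v) \<longrightarrow> v @ u \<in> avoiding}" (is "?L = ?R")
proof (intro set_eqI iffI)
  fix x assume "x \<in> ?L"
  then have red: "reduced S m x"
    and cfc: "\<And>y k. y \<in> red_exprs S m x \<Longrightarrow> rotate k y \<in> avoiding"
    by (auto simp: cyc_fully_commutative_def avoiding_iff)
  have "x \<in> red_exprs S m x" using red reduced_lists by (simp add: red_exprs_def same_elem_def)
  from cfc[OF this, of 0] have x: "x \<in> avoiding" by simp
  have "v @ u \<in> avoiding" if "Tr x (u @ v)" for u v
    using cfc[of "u @ v" "length u"] that avoiding_red_exprs[OF x] by (simp add: rotate_append)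
  then show "x \<in> ?R" using red reduced_lists by blast
next
  fix x assume x: "x \<in> ?R"
  then have "Tr x ([] @ x) \<longrightarrow> x @ [] \<in> avoiding" by blast
  then have "x \<in> avoiding" by simp
  note red = avoiding_red_exprs[OF this] and red_x = avoiding_imp_reduced[OF this]
  have "rotate k y \<in> avoiding" if "Tr x y" for k y
  proof -
    have "Tr x (take (k mod length y) y @ drop (k mod length y) y)" using that by simp
    then show ?thesis using x unfolding rotate_drop_take by blast
  qed
  then show "x \<in> ?L" using red_x by (auto simp: cyc_fully_commutative_def red avoiding_iff)
qed

lemma regular_lang_cyc_fully_commutative:
  "regular_lang S {x. reduced S m x \<and> cyc_fully_commutative S m x}"
  using forbidden_length_bounded regular_lang_cyclic_factor_avoiding[of forbidden]
  unfolding cyc_fully_commutative_iff avoiding_def by blast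

end

theorem theorem3:
  fixes S :: "'a set" and m :: "'a \<Rightarrow> 'a \<Rightarrow> enat"
  assumes "finite S" and "coxeter_matrix S m"
  shows "regular_lang S {x. reduced S m x \<and> cyc_fully_commutative S m x}"
proof -
  interpret coxeter_system S m using assms by unfold_locales
  show ?thesis by (rule regular_lang_cyc_fully_commutative)
qed

end
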